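(* Let $T$ be a Berge trigraph and $(A_1,B_1,C_1,A_2,B_2,C_2)$ a split of a proper $2$-join of $T$. Then all paths with one end in $A_i$, one end in $B_i$ and interior in $C_i$, for $i=1,2$ (i.e., over both values of $i$ together), have lengths of the same parity.
   Context: A trigraph $T$ consists of a finite vertex set $V(T)$ and a map $\theta:\binom{V(T)}{2}\to\{-1,0,1\}$. Distinct $u,v$ are strongly adjacent if $\theta(uv)=1$, strongly antiadjacent if $\theta(uv)=-1$, a switchable pair if $\theta(uv)=0$; adjacent if $\theta(uv)\in\{0,1\}$, antiadjacent if $\theta(uv)\in\{-1,0\}$. The complement $\overline T$ has adjacency $-\theta$; $T|X$ is the induced trigraph. The full realization of $T$ is the graph on $V(T)$ whose edges are adjacent pairs; $X$ is connected if the full realization of $T|X$ is connected; components are maximal connected sets. A path is a sequence $p_1,\dots,p_k$ of distinct vertices with consecutive ones adjacent and non-consecutive ones antiadjacent; its length is $k-1$, its interior $\{p_2,\dots,p_{k-1}\}$. A hole is $h_1,\dots,h_k$, $k\ge4$, distinct, with $h_i,h_j$ adjacent iff $|i-j|\in\{1,k-1\}$ and antiadjacent otherwise; an antihole is an induced subtrigraph whose complement is a hole of $\overline T$. $T$ is Berge if it has no hole and no antihole of odd length. A $2$-join of $T$ is a partition $(X_1,X_2)$ of $V(T)$ for which there are disjoint sets $A_1,B_1,C_1,A_2,B_2,C_2$ (a split) with $X_i=A_i\cup B_i\cup C_i$, $A_1,A_2,B_1,B_2$ nonempty, no switchable pair meeting both $X_1$ and $X_2$, every vertex of $A_1$ strongly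 adjacent to every vertex of $A_2$, every vertex of $B_1$ strongly adjacent to every vertex of $B_2$, no other strongly adjacent pairs between $X_1$ and $X_2$, $|X_i|\ge3$, and for $i=1,2$, if $|A_i|=|B_i|=1$ then the full realization of $T|X_i$ is not a path of length two joining the vertex of $A_i$ to that of $B_i$. It is proper if for $i=1,2$ every component of $T|X_i$ meets both $A_i$ and $B_i$.
   Formalization: In the definition of a hole, "adjacent iff |i-j| is 1 or k-1" is read as "adjacent if |i-j| is 1 or k-1, antiadjacent otherwise", so non-consecutive vertices may form switchable pairs, as in paths; with the literal "iff" the claim fails. *)

theory Defs
  imports "Graph_Theory.Digraph_Component"
begin

text \<open>The map \<open>theta\<close> is only meaningful on the two-element subsets of \<open>vertices\<close>.\<close>

record 'a trigraph =
  vertices :: "'a set"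
  theta :: "'a set \<Rightarrow> int"

definition is_trigraph :: "'a trigraph \<Rightarrow> bool" where
  "is_trigraph T \<longleftrightarrow> finite (vertices T) \<and>
     (\<forall>u\<in>vertices T. \<forall>v\<in>vertices T. u \<noteq> v \<longrightarrow> theta T {u, v} \<in> {-1, 0, 1})"

definition distinct_verts :: "'a trigraph \<Rightarrow> 'a \<Rightarrow> 'a \<Rightarrow> bool" where
  "distinct_verts T u v \<longleftrightarrow> u \<in> vertices T \<and> v \<in> vertices T \<and> u \<noteq> v"

definition strongly_adjacent :: "'a trigraph \<Rightarrow> 'a \<Rightarrow> 'a \<Rightarrow> bool" where
  "strongly_adjacent T u v \<longleftrightarrow> distinct_verts T u v \<and> theta T {u, v} = 1"

definition switchable :: "'a trigraph \<Rightarrow> 'a \<Rightarrow> 'a \<Rightarrow> bool" where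
  "switchable T u v \<longleftrightarrow> distinct_verts T u v \<and> theta T {u, v} = 0"

definition adjacent :: "'a trigraph \<Rightarrow> 'a \<Rightarrow> 'a \<Rightarrow> bool" where
  "adjacent T u v \<longleftrightarrow> distinct_verts T u v \<and> theta T {u, v} \<in> {0, 1}"

definition antiadjacent :: "'a trigraph \<Rightarrow> 'a \<Rightarrow> 'a \<Rightarrow> bool" where
  "antiadjacent T u v \<longleftrightarrow> distinct_verts T u v \<and> theta T {u, v} \<in> {-1, 0}"

definition complement :: "'a trigraph \<Rightarrow> 'a trigraph" where
  "complement T = \<lparr>vertices = vertices T, theta = (\<lambda>e. - theta T e)\<rparr>"

definition induced :: "'a trigraph \<Rightarrow> 'a set \<Rightarrow> 'a trigraph" where
  "induced T X = \<lparr>vertices = vertices T \<inter> X, theta = theta T\<rparr>"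

text \<open>Undirected simple graphs are symmetric loop-free digraphs, as in the locale \<open>pair_graph\<close>.\<close>

definition full_realization :: "'a trigraph \<Rightarrow> 'a pair_pre_digraph" where
  "full_realization T = \<lparr>pverts = vertices T, parcs = {(u, v). adjacent T u v}\<rparr>"

lemma pair_graph_full_realization:
  assumes "is_trigraph T"
  shows "pair_graph (full_realization T)"
proof -
  let ?G = "full_realization T"
  have sub: "parcs ?G \<subseteq> vertices T \<times> vertices T"
    by (auto simp: full_realization_def adjacent_def distinct_verts_def)
  have fin: "finite (vertices T)"
    using assms by (simp add: is_trigraph_def)
  have "finite (parcs ?G)"
    using sub fin by (meson finite_SigmaI finite_subset)
  moreover have "sym (parcs ?G)"
    unfolding sym_def full_realization_def adjacent_def distinct_verts_def
    by (auto simp: insert_commute[of _ _ "{}"])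
  moreover have "fst e \<noteq> snd e" if "e \<in> parcs ?G" for e
    using that by (auto simp: full_realization_def adjacent_def distinct_verts_def)
  moreover have "pverts ?G = vertices T"
    by (simp add: full_realization_def)
  ultimately show ?thesis
    using sub fin by unfold_locales (auto simp: symmetric_def)
qed

definition connected_set :: "'a trigraph \<Rightarrow> 'a set \<Rightarrow> bool" where
  "connected_set T X \<longleftrightarrow> X \<subseteq> vertices T \<and>
     Digraph_Component.connected (with_proj (full_realization (induced T X)))"

definition components :: "'a trigraph \<Rightarrow> 'a set set" where
  "components T = {Y. connected_set T Y \<and> (\<forall>Z. connected_set T Z \<and> Y \<subseteq> Z \<longrightarrow> Z = Y)}"

definition is_path :: "'a trigraph \<Rightarrow> 'a list \<Rightarrow> bool" where
  "is_path T p \<longleftrightarrow> p \<noteq> [] \<and> set p \<subseteq> vertices T \<and> distinct p \<and>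
     (\<forall>i j. i < j \<and> j < length p \<longrightarrow>
        (if j - i = 1 then adjacent T (p ! i) (p ! j) else antiadjacent T (p ! i) (p ! j)))"

definition path_length :: "'a list \<Rightarrow> nat" where
  "path_length p = length p - 1"

definition interior :: "'a list \<Rightarrow> 'a set" where
  "interior p = set (butlast (tl p))"

text \<open>Non-consecutive vertices of a hole are antiadjacent, so they may form switchable pairs,
  exactly as for paths.\<close>

definition is_hole :: "'a trigraph \<Rightarrow> 'a list \<Rightarrow> bool" where
  "is_hole T h \<longleftrightarrow> 4 \<le> length h \<and> set h \<subseteq> vertices T \<and> distinct h \<and>
     (\<forall>i j. i < j \<and> j < length h \<longrightarrow>
        (if j - i \<in> {1, length h - 1}
         then adjacent T (h ! i) (h ! j) else antiadjacent T (h ! i) (h ! j)))"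

definition is_antihole :: "'a trigraph \<Rightarrow> 'a list \<Rightarrow> bool" where
  "is_antihole T h \<longleftrightarrow> is_hole (complement T) h"

definition Berge :: "'a trigraph \<Rightarrow> bool" where
  "Berge T \<longleftrightarrow> (\<forall>h. is_hole T h \<or> is_antihole T h \<longrightarrow> even (length h))"

definition is_path_graph :: "'a pair_pre_digraph \<Rightarrow> nat \<Rightarrow> 'a \<Rightarrow> 'a \<Rightarrow> bool" where
  "is_path_graph G n a b \<longleftrightarrow>
     (\<exists>p. length p = n + 1 \<and> distinct p \<and> hd p = a \<and> last p = b \<and> pverts G = set p \<and>
        parcs G = {(p ! i, p ! j) | i j.
          i < length p \<and> j < length p \<and> (j = i + 1 \<or> i = j + 1)})"

definition not_short_side :: "'a trigraph \<Rightarrow> 'a set \<Rightarrow> 'a set \<Rightarrow> 'a set \<Rightarrow> bool" where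
  "not_short_side T X A B \<longleftrightarrow>
     (\<forall>a b. A = {a} \<and> B = {b} \<longrightarrow> \<not> is_path_graph (full_realization (induced T X)) 2 a b)"

definition two_join_split ::
  "'a trigraph \<Rightarrow> 'a set \<Rightarrow> 'a set \<Rightarrow>
   'a set \<Rightarrow> 'a set \<Rightarrow> 'a set \<Rightarrow> 'a set \<Rightarrow> 'a set \<Rightarrow> 'a set \<Rightarrow> bool" where
  "two_join_split T X1 X2 A1 B1 C1 A2 B2 C2 \<longleftrightarrow>
     X1 \<union> X2 = vertices T \<and> X1 \<inter> X2 = {} \<and>
     X1 = A1 \<union> B1 \<union> C1 \<and> X2 = A2 \<union> B2 \<union> C2 \<and>
     A1 \<inter> B1 = {} \<and> A1 \<inter> C1 = {} \<and> B1 \<inter> C1 = {} \<and>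
     A2 \<inter> B2 = {} \<and> A2 \<inter> C2 = {} \<and> B2 \<inter> C2 = {} \<and>
     A1 \<noteq> {} \<and> A2 \<noteq> {} \<and> B1 \<noteq> {} \<and> B2 \<noteq> {} \<and>
     (\<forall>u\<in>X1. \<forall>v\<in>X2. \<not> switchable T u v) \<and>
     (\<forall>u\<in>A1. \<forall>v\<in>A2. strongly_adjacent T u v) \<and>
     (\<forall>u\<in>B1. \<forall>v\<in>B2. strongly_adjacent T u v) \<and>
     (\<forall>u\<in>X1. \<forall>v\<in>X2. strongly_adjacent T u v \<longrightarrow>
        (u \<in> A1 \<and> v \<in> A2) \<or> (u \<in> B1 \<and> v \<in> B2)) \<and>
     3 \<le> card X1 \<and> 3 \<le> card X2 \<and>
     not_short_side T X1 A1 B1 \<and> not_short_side T X2 A2 B2"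

definition proper_two_join_split ::
  "'a trigraph \<Rightarrow> 'a set \<Rightarrow> 'a set \<Rightarrow>
   'a set \<Rightarrow> 'a set \<Rightarrow> 'a set \<Rightarrow> 'a set \<Rightarrow> 'a set \<Rightarrow> 'a set \<Rightarrow> bool" where
  "proper_two_join_split T X1 X2 A1 B1 C1 A2 B2 C2 \<longleftrightarrow>
     two_join_split T X1 X2 A1 B1 C1 A2 B2 C2 \<and>
     (\<forall>Y\<in>components (induced T X1). Y \<inter> A1 \<noteq> {} \<and> Y \<inter> B1 \<noteq> {}) \<and>
     (\<forall>Y\<in>components (induced T X2). Y \<inter> A2 \<noteq> {} \<and> Y \<inter> B2 \<noteq> {})"

definition paths_through :: "'a trigraph \<Rightarrow> 'a set \<Rightarrow> 'a set \<Rightarrow> 'a set \<Rightarrow> 'a list set" where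
  "paths_through T A B C = {p. is_path T p \<and>
     (hd p \<in> A \<and> last p \<in> B \<or> hd p \<in> B \<and> last p \<in> A) \<and> interior p \<subseteq> C}"

end

theory Submission
  imports Defs
begin

text \<open>A path from \<open>A1\<close> to \<open>B1\<close> through \<open>C1\<close> followed by a path from \<open>B2\<close> to \<open>A2\<close> through \<open>C2\<close>
  closes up to a hole, which has even length; hence paths on opposite sides have the same parity.
  Two paths on the same side are compared through a path on the other side: properness puts
  a vertex of \<open>A\<close> and a vertex of \<open>B\<close> in one component of that side, and a shortest walk from
  \<open>A\<close> to \<open>B\<close> there is a path with interior in \<open>C\<close>.\<close>

section \<open>Symmetry of adjacency and reversal of paths\<close>

lemma adjacent_commute: "adjacent T u v \<longleftrightarrow> adjacent T v u"
  unfolding adjacent_def distinct_verts_def by (auto simp: insert_commute[of u v])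

lemma antiadjacent_commute: "antiadjacent T u v \<longleftrightarrow> antiadjacent T v u"
  unfolding antiadjacent_def distinct_verts_def by (auto simp: insert_commute[of u v])

lemma not_adjacent_imp_antiadjacent:
  assumes "is_trigraph T" "u \<in> vertices T" "v \<in> vertices T" "u \<noteq> v" "\<not> adjacent T u v"
  shows "antiadjacent T u v"
  using assms unfolding is_trigraph_def adjacent_def antiadjacent_def distinct_verts_def by auto

lemma is_path_rev:
  assumes "is_path T p"
  shows "is_path T (rev p)"
proof -
  have "if j - i = 1 then adjacent T (rev p ! i) (rev p ! j)
        else antiadjacent T (rev p ! i) (rev p ! j)" if "i < j" "j < length p" for i j
  proof -
    let ?i = "length p - Suc j" and ?j = "length p - Suc i"
    have ij: "?i < ?j" "?j < length p" "?j - ?i = j - i" using that by auto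
    have "if ?j - ?i = 1 then adjacent T (p ! ?i) (p ! ?j) else antiadjacent T (p ! ?i) (p ! ?j)"
      using assms ij(1,2) unfolding is_path_def by blast
    then show ?thesis
      using that by (simp add: ij(3) rev_nth adjacent_commute[of T "p ! ?i"]
          antiadjacent_commute[of T "p ! ?i"] split: if_splits)
  qed
  then show ?thesis using assms unfolding is_path_def by simp
qed

lemma interior_rev: "interior (rev p) = interior p"
  by (metis butlast_rev butlast_tl interior_def rev_rev_ident set_rev)

text \<open>\<open>paths_through\<close> admits both orientations. Reversal preserves paths,
  interiors and lengths, so parity arguments may fix the direction from \<open>A\<close> to
  \<open>B\<close>.\<close>

lemma paths_through_oriented:
  assumes "p \<in> paths_through T A B C"
  obtains r where "is_path T r" "hd r \<in> A" "last r \<in> B" "interior r \<subseteq> C" "length r = length p"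
proof -
  have p: "is_path T p" "interior p \<subseteq> C" "hd p \<in> A \<and> last p \<in> B \<or> hd p \<in> B \<and> last p \<in> A"
    using assms by (auto simp: paths_through_def)
  show thesis
  proof (cases "hd p \<in> A \<and> last p \<in> B")
    case True
    then show thesis using that p by blast
  next
    case False
    then show thesis
      using that[of "rev p"] p is_path_rev interior_rev by (metis hd_rev last_rev length_rev)
  qed
qed

section \<open>Holes across the 2-join\<close>

lemma nth_in_interior:
  assumes "0 < i" "Suc i < length p"
  shows "p ! i \<in> interior p"
proof -
  have "butlast (tl p) ! (i - 1) = p ! i"
    using assms by (simp add: nth_butlast nth_tl)
  moreover have "i - 1 < length (butlast (tl p))" using assms by auto
  ultimately show ?thesis unfolding interior_def by (metis nth_mem)
qed

text \<open>Disjointness of the three sets lets membership in \<open>A\<close> or \<open>B\<close>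
  be read off the index. This later turns adjacency across the join into arithmetic on
  indices.\<close>

lemma path_nth_sides:
  assumes "hd p \<in> A" "last p \<in> B" "interior p \<subseteq> C" "p \<noteq> []"
    and "A \<inter> B = {}" "A \<inter> C = {}" "B \<inter> C = {}" and i: "i < length p"
  shows "p ! i \<in> A \<longleftrightarrow> i = 0" "p ! i \<in> B \<longleftrightarrow> i = length p - 1" "p ! i \<in> A \<union> B \<union> C"
proof -
  have ends: "p ! 0 \<in> A" "p ! (length p - 1) \<in> B"
    using assms(1,2,4) by (simp_all add: hd_conv_nth last_conv_nth)
  have mid: "p ! i \<in> C" if "i \<noteq> 0" "i \<noteq> length p - 1"
    using nth_in_interior[of i p] that i assms(3) by auto
  show "p ! i \<in> A \<longleftrightarrow> i = 0" using ends mid assms(5,6) by (metis IntI empty_iff)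
  show "p ! i \<in> B \<longleftrightarrow> i = length p - 1" using ends mid assms(5,7) by (metis IntI empty_iff)
  show "p ! i \<in> A \<union> B \<union> C" using ends mid by (metis UnI1 UnI2)
qed

text \<open>With no switchable pair across the join, \<open>theta\<close> is 1 or -1 there, and the
  split says exactly where it is 1.\<close>

lemma two_join_split_cross:
  assumes T: "is_trigraph T" and S: "two_join_split T X1 X2 A1 B1 C1 A2 B2 C2"
    and u: "u \<in> X1" and v: "v \<in> X2"
  shows "if u \<in> A1 \<and> v \<in> A2 \<or> u \<in> B1 \<and> v \<in> B2 then adjacent T u v else antiadjacent T u v"
proof -
  have "u \<in> vertices T" "v \<in> vertices T" "u \<noteq> v"
    using S u v unfolding two_join_split_def by auto
  then have th: "theta T {u, v} \<in> {-1, 0, 1}" and d: "distinct_verts T u v"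
    using T unfolding is_trigraph_def distinct_verts_def by blast+
  have "\<not> switchable T u v" using S u v unfolding two_join_split_def by blast
  moreover have "strongly_adjacent T u v \<longleftrightarrow> u \<in> A1 \<and> v \<in> A2 \<or> u \<in> B1 \<and> v \<in> B2"
    using S u v unfolding two_join_split_def by blast
  ultimately show ?thesis
    using th d unfolding switchable_def strongly_adjacent_def adjacent_def antiadjacent_def by auto
qed

text \<open>Since \<open>q\<close> runs backwards, from \<open>B2\<close> to \<open>A2\<close>, the
  concatenation crosses the join once between \<open>B1\<close> and \<open>B2\<close> and closes up
  between \<open>A2\<close> and \<open>A1\<close>. All other pairs across the join are
  antiadjacent.\<close>

lemma hole_of_opposite_paths:
  assumes T: "is_trigraph T" and S: "two_join_split T X1 X2 A1 B1 C1 A2 B2 C2"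
    and p: "is_path T p" "hd p \<in> A1" "last p \<in> B1" "interior p \<subseteq> C1"
    and q: "is_path T q" "hd q \<in> B2" "last q \<in> A2" "interior q \<subseteq> C2"
  shows "is_hole T (p @ q)"
proof -
  let ?n = "length p" and ?m = "length q"
  have X: "X1 = A1 \<union> B1 \<union> C1" "X2 = A2 \<union> B2 \<union> C2" "X1 \<inter> X2 = {}"
    and disj: "A1 \<inter> B1 = {}" "A1 \<inter> C1 = {}" "B1 \<inter> C1 = {}"
      "A2 \<inter> B2 = {}" "B2 \<inter> C2 = {}" "A2 \<inter> C2 = {}"
    using S unfolding two_join_split_def by - (elim conjE, assumption)+
  have ne: "p \<noteq> []" "q \<noteq> []" using p q unfolding is_path_def by auto
  note ps = path_nth_sides[OF p(2-4) ne(1) disj(1-3)]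
  \<comment> \<open>The roles of \<open>A\<close> and \<open>B\<close> are exchanged here: index 0
    of \<open>q\<close> is its only vertex in \<open>B2\<close>, the last index its only vertex in
    \<open>A2\<close>.\<close>
  note qs = path_nth_sides[OF q(2-4) ne(2) disj(4)[unfolded Int_commute[of A2]] disj(5,6)]
  have pX: "p ! i \<in> X1" if "i < ?n" for i using ps(3) that X by auto
  have qX: "q ! i \<in> X2" if "i < ?m" for i using qs(3) that X by auto
  \<comment> \<open>The vertex of a one-vertex path would lie in both end sets, which are disjoint.
    Two vertices on each path give a cycle of length at least 4.\<close>
  have "?n \<noteq> 1"
    using p(2,3) disj(1) by (cases p) auto
  moreover have "?m \<noteq> 1"
    using q(2,3) disj(4) by (cases q) auto
  ultimately have n: "?n \<ge> 2" and m: "?m \<ge> 2"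
    using ne by (metis One_nat_def Suc_1 Suc_leI le_neq_implies_less length_0_conv not_gr_zero)+
  have "set p \<inter> set q = {}"
  proof -
    have "set p \<subseteq> X1" "set q \<subseteq> X2" using pX qX by (metis in_set_conv_nth subsetI)+
    then show ?thesis using X(3) by blast
  qed
  then have dist: "distinct (p @ q)" and sub: "set (p @ q) \<subseteq> vertices T"
    using p(1) q(1) unfolding is_path_def by auto
  have "if j - i \<in> {1, length (p @ q) - 1}
        then adjacent T ((p @ q) ! i) ((p @ q) ! j) else antiadjacent T ((p @ q) ! i) ((p @ q) ! j)"
    if ij: "i < j" "j < length (p @ q)" for i j
  proof -
    consider "j < ?n" | "?n \<le> i" | "i < ?n" "?n \<le> j" by linarith
    then show ?thesis
    proof cases
      case 1
      then have "if j - i = 1 then adjacent T (p ! i) (p ! j) else antiadjacent T (p ! i) (p ! j)"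
        using p(1) ij(1) unfolding is_path_def by blast
      \<comment> \<open>The difference \<open>length (p @ q) - 1\<close> occurs only between the
        first vertex of \<open>p\<close> and the last of \<open>q\<close>, so never within one
        path.\<close>
      moreover have "j - i \<noteq> length (p @ q) - 1" using 1 m by auto
      ultimately show ?thesis using 1 ij(1) by (simp add: nth_append split: if_splits)
    next
      case 2
      let ?i = "i - ?n" and ?j = "j - ?n"
      have k: "?i < ?j" "?j < ?m" "?j - ?i = j - i" using 2 ij by auto
      have "if ?j - ?i = 1 then adjacent T (q ! ?i) (q ! ?j) else antiadjacent T (q ! ?i) (q ! ?j)"
        using q(1) k(1,2) unfolding is_path_def by blast
      moreover have "j - i \<noteq> length (p @ q) - 1" using 2 ij n by auto
      ultimately show ?thesis using 2 ij(1) k(3) by (simp add: nth_append split: if_splits)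
    next
      case 3
      let ?j = "j - ?n"
      have j: "?j < ?m" using 3 ij by auto
      have "p ! i \<in> A1 \<and> q ! ?j \<in> A2 \<or> p ! i \<in> B1 \<and> q ! ?j \<in> B2 \<longleftrightarrow>
          i = 0 \<and> ?j = ?m - 1 \<or> i = ?n - 1 \<and> ?j = 0"
        using ps(1,2)[OF 3(1)] qs(1,2)[OF j] by blast
      \<comment> \<open>The closing edge gives the difference \<open>?n + ?m - 1\<close>, the
        junction of \<open>p\<close> and \<open>q\<close> the difference 1.\<close>
      also have "\<dots> \<longleftrightarrow> j - i \<in> {1, length (p @ q) - 1}"
        using 3 ij n m by auto
      finally show ?thesis
        using two_join_split_cross[OF T S pX[OF 3(1)] qX[OF j]] 3 by (simp add: nth_append)
    qed
  qed
  then show ?thesis using n m dist sub unfolding is_hole_def by simp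
qed

lemma opposite_paths_same_parity:
  assumes "is_trigraph T" "Berge T" "two_join_split T X1 X2 A1 B1 C1 A2 B2 C2"
    and p: "p \<in> paths_through T A1 B1 C1" and q: "q \<in> paths_through T A2 B2 C2"
  shows "even (path_length p) \<longleftrightarrow> even (path_length q)"
proof -
  obtain r where r: "is_path T r" "hd r \<in> A1" "last r \<in> B1" "interior r \<subseteq> C1"
      "length r = length p"
    using paths_through_oriented[OF p] .
  \<comment> \<open>Exchanging the end sets makes the oriented copy of \<open>q\<close> start in
    \<open>B2\<close>.\<close>
  have "q \<in> paths_through T B2 A2 C2" using q unfolding paths_through_def by auto
  then obtain s where s: "is_path T s" "hd s \<in> B2" "last s \<in> A2" "interior s \<subseteq> C2"
      "length s = length q"
    by (rule paths_through_oriented)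
  have "even (length (r @ s))"
    using hole_of_opposite_paths[OF assms(1,3) r(1-4) s(1-4)] assms(2) unfolding Berge_def by blast
  then have "even (length p + length q)" using r s by simp
  \<comment> \<open>\<open>path_length\<close> uses truncated subtraction, which flips parity only
    for nonempty lists.\<close>
  moreover have "length p \<noteq> 0" "length q \<noteq> 0"
    using p q unfolding paths_through_def is_path_def by auto
  ultimately show ?thesis unfolding path_length_def by auto
qed

section \<open>Shortest walks between the end sets\<close>

lemma rtrancl_imp_successively:
  assumes "(a, b) \<in> R\<^sup>*"
  shows "\<exists>p. p \<noteq> [] \<and> hd p = a \<and> last p = b \<and> successively (\<lambda>u v. (u, v) \<in> R) p"
  using assms
proof (induction rule: rtrancl_induct)
  case base
  show ?case by (rule exI[of _ "[a]"]) simp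
next
  case (step y z)
  then obtain p where "p \<noteq> []" "hd p = a" "last p = y" "successively (\<lambda>u v. (u, v) \<in> R) p" by blast
  then show ?case
    using step by (intro exI[of _ "p @ [z]"]) (auto simp: successively_append_iff)
qed

text \<open>Minimality is over all walks from \<open>A\<close> to \<open>B\<close>, with free ends.
  Hence a later vertex in \<open>A\<close> or an earlier one in \<open>B\<close> would permit
  trimming, a chord would permit a shortcut, and a repeated vertex reduces to one of these
  cases.\<close>

lemma shortest_walk_is_path:
  assumes T: "is_trigraph T" and XT: "A \<union> B \<union> C \<subseteq> vertices T"
    and p: "p \<noteq> []" "hd p \<in> A" "last p \<in> B" "set p \<subseteq> A \<union> B \<union> C" "successively (adjacent T) p"
    and shortest: "\<And>q. \<lbrakk>q \<noteq> []; hd q \<in> A; last q \<in> B; set q \<subseteq> A \<union> B \<union> C;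
      successively (adjacent T) q\<rbrakk> \<Longrightarrow> length p \<le> length q"
  shows "p \<in> paths_through T A B C"
proof -
  let ?n = "length p"
  have suff: "successively (adjacent T) (drop j p)" and pref: "successively (adjacent T) (take j p)"
    for j
    using p(5) append_take_drop_id[of j p] successively_append_iff by metis+
  have sub: "set (take i p @ drop j p) \<subseteq> A \<union> B \<union> C" for i j
    using p(4) set_take_subset[of i p] set_drop_subset[of j p] by auto
  have notA: "p ! j \<notin> A" if "0 < j" "j < ?n" for j
  proof
    assume "p ! j \<in> A"
    then have "?n \<le> length (drop j p)"
      using shortest[of "drop j p"] that p sub[of 0 j] suff[of j] by (simp add: hd_drop_conv_nth)
    then show False using that by simp
  qed
  have notB: "p ! j \<notin> B" if "Suc j < ?n" for j
  proof
    assume "p ! j \<in> B"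
    moreover have "last (take (Suc j) p) = p ! j" "hd (take (Suc j) p) = hd p"
      using that by (simp_all add: take_Suc_conv_app_nth hd_append hd_conv_nth p(1))
    ultimately have "?n \<le> length (take (Suc j) p)"
      using shortest[of "take (Suc j) p"] that p sub[of "Suc j" ?n] pref[of "Suc j"] by simp
    then show False using that by simp
  qed
  have noshort: "\<not> adjacent T (p ! i) (p ! j)" if "Suc i < j" "j < ?n" for i j
  proof
    assume a: "adjacent T (p ! i) (p ! j)"
    \<comment> \<open>The chord replaces the stretch strictly between \<open>i\<close> and
      \<open>j\<close>, which contains at least one vertex.\<close>
    let ?q = "take (Suc i) p @ drop j p"
    have "last (take (Suc i) p) = p ! i" "hd (drop j p) = p ! j"
      using that by (simp_all add: take_Suc_conv_app_nth hd_drop_conv_nth)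
    then have "successively (adjacent T) ?q"
      using a suff[of j] pref[of "Suc i"] by (simp add: successively_append_iff)
    moreover have "hd ?q = hd p" "last ?q = last p" "?q \<noteq> []" using that p(1) by auto
    ultimately have "?n \<le> length ?q" using shortest[of ?q] p sub[of "Suc i" j] by metis
    then show False using that by simp
  qed
  have step: "adjacent T (p ! i) (p ! Suc i)" if "Suc i < ?n" for i
    using p(5) that by (simp add: successively_conv_nth)
  have neq: "p ! i \<noteq> p ! j" if "i < j" "j < ?n" for i j
  proof
    assume e: "p ! i = p ! j"
    show False
    proof (cases i)
      case 0
      then have "p ! i \<in> A" using p by (simp add: hd_conv_nth)
      then show False using notA[of j] that e by simp
    next
      case (Suc k)
      \<comment> \<open>The predecessor of the first occurrence is also adjacent to the second
        occurrence, which gives a chord.\<close>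
      then show False using noshort[of k j] step[of k] that e by simp
    qed
  qed
  then have dist: "distinct p" by (metis distinct_conv_nth nat_neq_iff)
  have inT: "p ! i \<in> vertices T" if "i < ?n" for i
    using that p(4) XT by (meson nth_mem subsetD)
  have "if j - i = 1 then adjacent T (p ! i) (p ! j) else antiadjacent T (p ! i) (p ! j)"
    if "i < j" "j < ?n" for i j
  proof (cases "j = Suc i")
    case True
    then show ?thesis using step that by simp
  next
    case False
    then show ?thesis
      using not_adjacent_imp_antiadjacent[OF T inT inT neq noshort, of i j] that by auto
  qed
  then have "is_path T p" using p dist XT unfolding is_path_def by blast
  moreover have "interior p \<subseteq> C"
  proof
    fix x assume "x \<in> interior p"
    then obtain i where i: "i < ?n - 2" "x = butlast (tl p) ! i"
      unfolding interior_def by (auto simp: in_set_conv_nth numeral_2_eq_2)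
    \<comment> \<open>Dropping the first vertex shifts indices by one; \<open>i < ?n - 2\<close>
      keeps \<open>Suc i\<close> away from both ends.\<close>
    then have "x = p ! Suc i" by (simp add: nth_butlast nth_tl)
    moreover have "p ! Suc i \<in> set p" "p ! Suc i \<notin> A" "p ! Suc i \<notin> B"
      using notA[of "Suc i"] notB[of "Suc i"] i(1) by simp_all
    ultimately show "x \<in> C" using p(4) by blast
  qed
  ultimately show ?thesis using p unfolding paths_through_def by simp
qed

section \<open>Components and connecting walks\<close>

lemma connected_set_singleton:
  assumes "a \<in> vertices T"
  shows "connected_set T {a}"
proof -
  let ?G = "with_proj (full_realization (induced T {a}))"
  have v: "verts (with_proj (mk_symmetric ?G)) = {a}"
    using assms by (auto simp: full_realization_def induced_def)
  have "a \<rightarrow>\<^sup>*\<^bsub>with_proj (mk_symmetric ?G)\<^esub> a"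
    unfolding reachable_def v by (rule rtrancl_on_refl) simp
  then have "strongly_connected (with_proj (mk_symmetric ?G))"
    unfolding strongly_connected_def v by simp
  then show ?thesis using assms unfolding connected_set_def Digraph_Component.connected_def by simp
qed

text \<open>A finite nonempty family of connected sets has a maximal member; singletons make it
  nonempty. Properness speaks about all components, so at least one must exist for it to yield end
  vertices.\<close>

lemma components_nonempty:
  assumes "finite (vertices T)" "a \<in> vertices T"
  shows "components T \<noteq> {}"
proof -
  let ?F = "{Y. connected_set T Y}"
  have "finite ?F" using assms(1) by (rule_tac finite_subset[of _ "Pow (vertices T)"])
      (auto simp: connected_set_def)
  moreover have "{a} \<in> ?F" using connected_set_singleton assms(2) by simp
  ultimately obtain M where "M \<in> ?F" "\<forall>Z\<in>?F. M \<subseteq> Z \<longrightarrow> M = Z"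
    using finite_has_maximal[of ?F] by blast
  then have "M \<in> components T" unfolding components_def by auto
  then show ?thesis by blast
qed

text \<open>Connectedness of a digraph is strong connectedness of its symmetric closure. Adjacency
  is already symmetric, so reachability there yields a walk of adjacent vertices.\<close>

lemma connected_set_imp_walk:
  assumes "connected_set T Y" "a \<in> Y" "b \<in> Y"
  shows "\<exists>p. p \<noteq> [] \<and> hd p = a \<and> last p = b \<and> set p \<subseteq> Y \<and> successively (adjacent T) p"
proof -
  let ?G = "with_proj (full_realization (induced T Y))"
  \<comment> \<open>Both ends are required to lie in \<open>Y\<close>, so that the walk extracted
    from the closure stays in \<open>Y\<close>.\<close>
  let ?R = "{(u, v). u \<in> Y \<and> v \<in> Y \<and> adjacent T u v}"
  let ?S = "with_proj (mk_symmetric ?G)"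
  have Y: "Y \<subseteq> vertices T" and "strongly_connected ?S"
    using assms(1) unfolding connected_set_def Digraph_Component.connected_def by auto
  moreover have "verts ?S = Y" using Y by (auto simp: full_realization_def induced_def)
  ultimately have "a \<rightarrow>\<^sup>*\<^bsub>?S\<^esub> b" using assms(2,3) unfolding strongly_connected_def by blast
  then have "(a, b) \<in> (arcs_ends ?S)\<^sup>*"
    unfolding reachable_def by (rule rtrancl_on_rtranclI)
  moreover have "arcs_ends ?S \<subseteq> ?R"
  proof -
    have "(u, v) \<in> ?R" if "adjacent (induced T Y) u v" for u v
      using that unfolding adjacent_def distinct_verts_def induced_def by auto
    moreover have "(v, u) \<in> ?R" if "(u, v) \<in> ?R" for u v
      using that by (simp add: adjacent_commute[of T v])
    moreover have "arcs_ends ?S = {(u, v). adjacent (induced T Y) u v \<or> adjacent (induced T Y) v u}"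
      by (auto simp: parcs_mk_symmetric full_realization_def)
    ultimately show ?thesis by blast
  qed
  ultimately have "(a, b) \<in> ?R\<^sup>*" using rtrancl_mono by blast
  from rtrancl_imp_successively[OF this]
  obtain p where p: "p \<noteq> []" "hd p = a" "last p = b" "successively (\<lambda>u v. (u, v) \<in> ?R) p"
    by (elim exE conjE)
  have "set p \<subseteq> Y"
  proof
    fix x assume "x \<in> set p"
    then obtain i where i: "i < length p" "x = p ! i" by (metis in_set_conv_nth)
    show "x \<in> Y"
    \<comment> \<open>Later vertices are targets of pairs in \<open>?R\<close>; the first needs
      \<open>a \<in> Y\<close>, since a one-vertex walk contains no pair.\<close>
    proof (cases i)
      case 0
      then show ?thesis using i p assms(2) by (simp add: hd_conv_nth)
    next
      case (Suc k)
      then show ?thesis using p(4) i by (simp add: successively_conv_nth)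
    qed
  qed
  moreover have "successively (adjacent T) p"
    using p(4) by (rule successively_mono) simp
  ultimately show ?thesis using p by blast
qed

section \<open>Existence of paths on each side\<close>

lemma adjacent_inducedD: "adjacent (induced T X) u v \<Longrightarrow> adjacent T u v"
  unfolding adjacent_def distinct_verts_def induced_def by auto

lemma paths_through_nonempty:
  assumes T: "is_trigraph T" and XT: "A \<union> B \<union> C \<subseteq> vertices T" and A: "A \<noteq> {}"
    and comp: "\<forall>Y\<in>components (induced T (A \<union> B \<union> C)). Y \<inter> A \<noteq> {} \<and> Y \<inter> B \<noteq> {}"
  shows "paths_through T A B C \<noteq> {}"
proof -
  let ?X = "A \<union> B \<union> C"
  let ?I = "induced T ?X"
  let ?W = "\<lambda>p. p \<noteq> [] \<and> hd p \<in> A \<and> last p \<in> B \<and> set p \<subseteq> ?X \<and> successively (adjacent T) p"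
  have vI: "vertices ?I = ?X" using XT by (auto simp: induced_def)
  then have "finite (vertices ?I)" using T XT unfolding is_trigraph_def by (metis finite_subset)
  moreover obtain a0 where "a0 \<in> vertices ?I" using A vI by auto
  ultimately obtain Y where Y: "Y \<in> components ?I"
    using components_nonempty by (metis ex_in_conv)
  then obtain a b where ab: "a \<in> Y" "a \<in> A" "b \<in> Y" "b \<in> B" using comp by blast
  have cY: "connected_set ?I Y" using Y unfolding components_def by simp
  then obtain p where p: "p \<noteq> []" "hd p = a" "last p = b" "set p \<subseteq> Y" "successively (adjacent ?I) p"
    using connected_set_imp_walk ab by metis
  have "successively (adjacent T) p"
    using p(5) by (rule successively_mono) (rule adjacent_inducedD)
  moreover have "Y \<subseteq> ?X" using cY vI unfolding connected_set_def by simp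
  ultimately have "?W p" using p ab by auto
  \<comment> \<open>The walk \<open>p\<close> only shows that walks exist; the minimum is taken over
    the whole side, not just over \<open>Y\<close>.\<close>
  then obtain q where "?W q" "\<forall>r. ?W r \<longrightarrow> length q \<le> length r"
    using ex_has_least_nat[of ?W p length] by blast
  then have "q \<in> paths_through T A B C"
    by (intro shortest_walk_is_path[OF T XT]) auto
  then show ?thesis by blast
qed

theorem theorem2p4:
  fixes T :: "'a trigraph" and X1 X2 A1 B1 C1 A2 B2 C2 :: "'a set"
  assumes "is_trigraph T"
    and "Berge T"
    and "proper_two_join_split T X1 X2 A1 B1 C1 A2 B2 C2"
  shows "\<forall>p \<in> paths_through T A1 B1 C1 \<union> paths_through T A2 B2 C2.
         \<forall>q \<in> paths_through T A1 B1 C1 \<union> paths_through T A2 B2 C2.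
           even (path_length p) \<longleftrightarrow> even (path_length q)"
proof -
  have S: "two_join_split T X1 X2 A1 B1 C1 A2 B2 C2"
    and comp: "\<forall>Y\<in>components (induced T X1). Y \<inter> A1 \<noteq> {} \<and> Y \<inter> B1 \<noteq> {}"
      "\<forall>Y\<in>components (induced T X2). Y \<inter> A2 \<noteq> {} \<and> Y \<inter> B2 \<noteq> {}"
    using assms(3) unfolding proper_two_join_split_def by auto
  have X: "X1 = A1 \<union> B1 \<union> C1" "X2 = A2 \<union> B2 \<union> C2" "X1 \<union> X2 = vertices T" "A1 \<noteq> {}" "A2 \<noteq> {}"
    using S unfolding two_join_split_def by - (elim conjE, assumption)+
  have "paths_through T A1 B1 C1 \<noteq> {}" "paths_through T A2 B2 C2 \<noteq> {}"
    using paths_through_nonempty[OF assms(1)] X comp by (metis Un_upper1 Un_upper2)+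
  then show ?thesis
    using opposite_paths_same_parity[OF assms(1,2) S] by blast
qed

end
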